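(* For $N=2^n$ and a unit vector $\boldsymbol{v}\in\mathbf{S}_{N-1}=\{\boldsymbol{v}\in\mathbb{R}^N:\|\boldsymbol{v}\|_2=1\}$, let $$\tau(\boldsymbol{v})=\frac{n}{\sqrt{\rho(\boldsymbol{v})}}=n\sqrt{N\,\|\boldsymbol{v}\|_\infty^2}.$$ If $\boldsymbol{v}$ is sampled uniformly at random from $\mathbf{S}_{N-1}$, then, as $N\to\infty$, $$\mathbf{E}[\tau(\boldsymbol{v})]=\mathcal{O}\!\left(n^{1.5}\right)=\mathcal{O}\!\left(\log^{1.5}N\right).$$
   Context: For $\boldsymbol{v}=(v_0,\dots,v_{N-1})\in\mathbb{R}^N$ nonzero, $\|\boldsymbol{v}\|_\infty=\max_i|v_i|$ and the data density is $\rho(\boldsymbol{v})=\frac1N\sum_{i=0}^{N-1}\left(v_i/\|\boldsymbol{v}\|_\infty\right)^2$, which equals $\frac{1}{N\|\boldsymbol{v}\|_\infty^2}$ when $\|\boldsymbol{v}\|_2=1$. The quantity $\tau(\boldsymbol{v})$ is, up to a constant factor, the total runtime (circuit depth) of the amplitude encoding algorithm in its most parallel version, and $n=\log_2 N$. *)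

theory Defs
  imports "HOL-Probability.Probability"
begin

text \<open>
  The dimension \<open>N = 2 ^ n\<close> varies inside the statement, so a vector of \<open>\<real>\<^sup>N\<close> is a
  function on the index set \<open>{..<N}\<close> (extensional outside it), and \<open>\<real>\<^sup>N\<close> carries the product
  of \<open>N\<close> copies of one-dimensional Lebesgue measure.
\<close>

definition RN :: "nat \<Rightarrow> (nat \<Rightarrow> real) measure" where
  "RN N = (\<Pi>\<^sub>M i\<in>{..<N}. lborel)"

abbreviation norm2 :: "nat \<Rightarrow> (nat \<Rightarrow> real) \<Rightarrow> real" where
  "norm2 N v \<equiv> L2_set v {..<N}"

definition norm_inf :: "nat \<Rightarrow> (nat \<Rightarrow> real) \<Rightarrow> real" where
  "norm_inf N v = Max ((\<lambda>i. \<bar>v i\<bar>) ` {..<N})"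

definition data_density :: "nat \<Rightarrow> (nat \<Rightarrow> real) \<Rightarrow> real" where
  "data_density N v = 1 / real N * (\<Sum>i<N. (v i / norm_inf N v)\<^sup>2)"

definition tau :: "nat \<Rightarrow> (nat \<Rightarrow> real) \<Rightarrow> real" where
  "tau n v = real n / sqrt (data_density (2 ^ n) v)"

definition unit_sphere :: "nat \<Rightarrow> (nat \<Rightarrow> real) set" where
  "unit_sphere N = {v \<in> space (RN N). norm2 N v = 1}"

text \<open>
  The uniform probability measure on the sphere is the normalised surface measure: a Borel set
  \<open>A\<close> of the sphere has probability \<open>vol {t a | 0 < t \<le> 1, a \<in> A} / vol (unit ball)\<close>.
  Equivalently, it is the law of \<open>x / \<parallel>x\<parallel>\<^sub>2\<close> for \<open>x\<close> uniform in the unit ball. The origin, a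
  null set for \<open>N \<ge> 1\<close>, is removed so that the radial projection is defined everywhere.
\<close>

definition punctured_ball :: "nat \<Rightarrow> (nat \<Rightarrow> real) set" where
  "punctured_ball N = {x \<in> space (RN N). 0 < norm2 N x \<and> norm2 N x \<le> 1}"

definition radial_proj :: "nat \<Rightarrow> (nat \<Rightarrow> real) \<Rightarrow> (nat \<Rightarrow> real)" where
  "radial_proj N x = (\<lambda>i\<in>{..<N}. x i / norm2 N x)"

definition uniform_sphere :: "nat \<Rightarrow> (nat \<Rightarrow> real) measure" where
  "uniform_sphere N =
     distr (uniform_measure (restrict_space (RN N) (punctured_ball N)) (punctured_ball N))
           (restrict_space (RN N) (unit_sphere N)) (radial_proj N)"

lemma space_RN: "space (RN N) = (\<Pi>\<^sub>E i\<in>{..<N}. UNIV)"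
  by (simp add: RN_def space_PiM)

lemma measurable_norm2 [measurable]: "norm2 N \<in> borel_measurable (RN N)"
  unfolding L2_set_def RN_def by measurable

lemma punctured_ball_sets [measurable]: "punctured_ball N \<in> sets (RN N)"
  unfolding punctured_ball_def by measurable

lemma unit_sphere_sets [measurable]: "unit_sphere N \<in> sets (RN N)"
  unfolding unit_sphere_def by measurable

lemma radial_proj_in_unit_sphere:
  assumes "x \<in> punctured_ball N"
  shows "radial_proj N x \<in> unit_sphere N"
proof -
  have p: "norm2 N x > 0" using assms by (simp add: punctured_ball_def)
  have "norm2 N (radial_proj N x) = L2_set (\<lambda>i. inverse (norm2 N x) * x i) {..<N}"
    by (rule L2_set_cong) (auto simp: radial_proj_def field_simps)
  also have "\<dots> = inverse (norm2 N x) * norm2 N x"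
    using p by (subst L2_set_right_distrib) auto
  finally show ?thesis using p by (auto simp: unit_sphere_def space_RN radial_proj_def)
qed

lemma measurable_radial_proj:
  "radial_proj N \<in> restrict_space (RN N) (punctured_ball N)
     \<rightarrow>\<^sub>M restrict_space (RN N) (unit_sphere N)"
proof (rule measurable_restrict_space2)
  show "radial_proj N \<in> space (restrict_space (RN N) (punctured_ball N)) \<rightarrow> unit_sphere N"
    using radial_proj_in_unit_sphere by (auto simp: space_restrict_space)
  have "radial_proj N \<in> RN N \<rightarrow>\<^sub>M RN N"
  proof -
    have [measurable]: "(\<lambda>x. norm2 N x) \<in> borel_measurable (Pi\<^sub>M {..<N} (\<lambda>_. lborel))"
      using measurable_norm2[of N] by (simp add: RN_def)
    show ?thesis
      unfolding RN_def radial_proj_def by measurable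
  qed
  then show "radial_proj N \<in> restrict_space (RN N) (punctured_ball N) \<rightarrow>\<^sub>M RN N"
    by (rule measurable_restrict_space1)
qed

lemma emeasure_punctured_ball:
  assumes "N > 0"
  shows "emeasure (RN N) (punctured_ball N) \<noteq> 0" "emeasure (RN N) (punctured_ball N) \<noteq> \<infinity>"
proof -
  interpret product_sigma_finite "\<lambda>_::nat. lborel :: real measure" by standard
  have box: "emeasure (RN N) (\<Pi>\<^sub>E i\<in>{..<N}. {a..b}) = (\<Prod>i<N. ennreal (b - a))"
    if "a \<le> b" for a b :: real
    unfolding RN_def using that by (subst emeasure_PiM) auto
  let ?c = "1 / real N"
  have "(\<Pi>\<^sub>E i\<in>{..<N}. {?c / 2..?c}) \<subseteq> punctured_ball N"
  proof
    fix x assume x: "x \<in> (\<Pi>\<^sub>E i\<in>{..<N}. {?c / 2..?c})"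
    then have xi: "?c / 2 \<le> x i" "x i \<le> ?c" if "i < N" for i
      using that by (auto simp: PiE_iff)
    have pos: "0 < x i" if "i < N" for i
      using xi(1)[OF that] assms by (smt (verit) divide_pos_pos of_nat_0_less_iff)
    have "norm2 N x \<le> (\<Sum>i<N. x i)"
      by (rule L2_set_le_sum) (use pos in \<open>auto intro: less_imp_le\<close>)
    also have "\<dots> \<le> (\<Sum>i<N. ?c)" by (rule sum_mono) (use xi in auto)
    also have "\<dots> = 1" using assms by simp
    finally have le: "norm2 N x \<le> 1" .
    have "x 0 \<le> norm2 N x" by (rule member_le_L2_set) (use assms in auto)
    then have "0 < norm2 N x" using pos[of 0] assms by auto
    then show "x \<in> punctured_ball N"
      using le x by (auto simp: punctured_ball_def space_RN PiE_iff)
  qed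
  then have "emeasure (RN N) (\<Pi>\<^sub>E i\<in>{..<N}. {?c / 2..?c}) \<le> emeasure (RN N) (punctured_ball N)"
    by (intro emeasure_mono) auto
  moreover have "emeasure (RN N) (\<Pi>\<^sub>E i\<in>{..<N}. {?c / 2..?c}) \<noteq> 0"
    using assms by (subst box) (auto simp: field_simps)
  ultimately show "emeasure (RN N) (punctured_ball N) \<noteq> 0" by (metis le_zero_eq)
  have "punctured_ball N \<subseteq> (\<Pi>\<^sub>E i\<in>{..<N}. {-1..1})"
  proof
    fix x assume x: "x \<in> punctured_ball N"
    have "\<bar>x i\<bar> \<le> 1" if "i < N" for i
    proof -
      have "\<bar>x i\<bar> \<le> L2_set (\<lambda>i. \<bar>x i\<bar>) {..<N}" by (rule member_le_L2_set) (use that in auto)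
      also have "\<dots> = norm2 N x" by (simp add: L2_set_def)
      finally show ?thesis using x by (simp add: punctured_ball_def)
    qed
    then show "x \<in> (\<Pi>\<^sub>E i\<in>{..<N}. {-1..1})"
      using x by (auto simp: punctured_ball_def space_RN PiE_iff abs_le_iff)
  qed
  moreover have "(\<Pi>\<^sub>E i\<in>{..<N}. {-1..1}) \<in> sets (RN N)"
    unfolding RN_def by (rule sets_PiM_I_finite) auto
  ultimately have "emeasure (RN N) (punctured_ball N) \<le> emeasure (RN N) (\<Pi>\<^sub>E i\<in>{..<N}. {-1..1})"
    by (intro emeasure_mono)
  also have "\<dots> < \<infinity>"
    by (subst box) (auto simp: ennreal_prod_eq_top less_top power_less_top_ennreal)
  finally show "emeasure (RN N) (punctured_ball N) \<noteq> \<infinity>" by simp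
qed

lemma space_uniform_sphere: "space (uniform_sphere N) = unit_sphere N"
  by (auto simp: uniform_sphere_def space_restrict_space unit_sphere_def)

lemma prob_space_uniform_sphere:
  assumes "N > 0"
  shows "prob_space (uniform_sphere N)"
proof -
  let ?B = "restrict_space (RN N) (punctured_ball N)"
  have "emeasure ?B (punctured_ball N) = emeasure (RN N) (punctured_ball N)"
    by (rule emeasure_restrict_space) auto
  then have "prob_space (uniform_measure ?B (punctured_ball N))"
    using emeasure_punctured_ball[OF assms] by (intro prob_space_uniform_measure) auto
  moreover have "radial_proj N \<in> uniform_measure ?B (punctured_ball N)
      \<rightarrow>\<^sub>M restrict_space (RN N) (unit_sphere N)"
    using measurable_radial_proj by simp
  ultimately show ?thesis
    unfolding uniform_sphere_def by (rule prob_space.prob_space_distr)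
qed

end

(*
  If v is a unit vector with v_i >= t, then the segment from 0 to v lies in the ball of centre t e_i
  and radius sqrt (1 - t^2), provided t^2 <= 1/2. Comparing volumes, the spherical cap has
  probability at most (1 - t^2)^(N/2) <= exp (- N t^2 / 2). A union bound over the 2 N caps around
  the points +-e_i gives E |v|_inf <= t + 2 N exp (- N t^2 / 2), and t^2 = 3 n / N makes the
  second term at most 2 / sqrt N.
*)
theory Submission
  imports Defs
begin

section \<open>Scaling of Lebesgue measure and volumes of balls\<close>

text \<open>By uniqueness of the product measure it suffices to compare \<open>RN N\<close> with
  \<open>r ^ N\<close> times its push-forward under \<open>T\<close> on boxes. There
  \<open>T\<close> acts coordinatewise and the one-dimensional affine rule applies.\<close>

lemma emeasure_RN_affine:
  fixes r :: real and c :: "nat \<Rightarrow> real"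
  assumes r: "r > 0" and A: "A \<in> sets (RN N)"
  defines "T \<equiv> \<lambda>x. \<lambda>i\<in>{..<N}. c i + r * x i"
  shows "emeasure (RN N) A = ennreal r ^ N * emeasure (RN N) (T -` A \<inter> space (RN N))"
proof -
  interpret product_sigma_finite "\<lambda>_::nat. lborel :: real measure" by standard
  have T: "T \<in> RN N \<rightarrow>\<^sub>M RN N"
    unfolding T_def RN_def by measurable
  let ?P = "scale_measure (ennreal r ^ N) (distr (RN N) (RN N) T)"
  have "?P = RN N"
    unfolding RN_def
  proof (rule PiM_eqI)
    fix B :: "nat \<Rightarrow> real set" assume B: "\<And>i. i \<in> {..<N} \<Longrightarrow> B i \<in> sets lborel"
    have BN: "Pi\<^sub>E {..<N} B \<in> sets (RN N)"
      unfolding RN_def using B by (intro sets_PiM_I_finite) auto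
    have pre: "T -` Pi\<^sub>E {..<N} B \<inter> space (RN N) = (\<Pi>\<^sub>E i\<in>{..<N}. (\<lambda>x. c i + r * x) -` B i)"
      by (auto simp: T_def space_RN PiE_iff extensional_def)
    have M: "(\<lambda>x. c i + r * x) -` B i \<in> sets borel" if "i < N" for i
      using measurable_sets[of "\<lambda>x. c i + r * x" lborel borel "B i"] B[of i] that by simp
    \<comment> \<open>The one-dimensional scaling rule; one factor \<open>r\<close> per coordinate
      produces \<open>r ^ N\<close>.\<close>
    have S: "emeasure lborel (B i) = ennreal r * emeasure lborel ((\<lambda>x. c i + r * x) -` B i)"
      if "i < N" for i
    proof -
      have Bi: "B i \<in> sets borel" using B[of i] that by simp
      have "emeasure lborel (B i) = emeasure (density (distr lborel borel (\<lambda>x. c i + r * x)) (\<lambda>_. ennreal \<bar>r\<bar>)) (B i)"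
        using lborel_real_affine[of r "c i"] r by simp
      also have "\<dots> = ennreal r * emeasure lborel ((\<lambda>x. c i + r * x) -` B i)"
        using r Bi by (simp add: emeasure_density nn_integral_cmult_indicator emeasure_distr)
      finally show ?thesis .
    qed
    have "emeasure ?P (Pi\<^sub>E {..<N} B) = ennreal r ^ N * emeasure (RN N) (\<Pi>\<^sub>E i\<in>{..<N}. (\<lambda>x. c i + r * x) -` B i)"
      using T BN by (simp add: emeasure_distr pre)
    also have "\<dots> = ennreal r ^ N * (\<Prod>i<N. emeasure lborel ((\<lambda>x. c i + r * x) -` B i))"
      unfolding RN_def by (subst emeasure_PiM) (simp_all add: M)
    also have "\<dots> = (\<Prod>i<N. emeasure lborel (B i))"
      using S by (simp add: prod.distrib)
    finally show "emeasure (scale_measure (ennreal r ^ N) (distr (Pi\<^sub>M {..<N} (\<lambda>i. lborel)) (Pi\<^sub>M {..<N} (\<lambda>i. lborel)) T))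
        (Pi\<^sub>E {..<N} B) = (\<Prod>i<N. emeasure lborel (B i))"
      by (simp add: RN_def)
  qed (auto simp: RN_def)
  then have "emeasure (RN N) A = emeasure ?P A" by simp
  also have "\<dots> = ennreal r ^ N * emeasure (RN N) (T -` A \<inter> space (RN N))"
    using T A by (simp add: emeasure_distr)
  finally show ?thesis .
qed

text \<open>The map \<open>x \<mapsto> c + r x\<close> carries the unit ball onto the given ball.
  The volume is expressed through \<open>punctured_ball\<close> so that it cancels against the
  normalising constant of \<open>uniform_sphere\<close>.\<close>

lemma emeasure_RN_ball:
  assumes N: "N > 0" and r: "r > 0"
  shows "emeasure (RN N) {x \<in> space (RN N). norm2 N (\<lambda>i. x i - c i) \<le> r}
    = ennreal r ^ N * emeasure (RN N) (punctured_ball N)"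
proof -
  interpret product_sigma_finite "\<lambda>_::nat. lborel :: real measure" by standard
  let ?T = "\<lambda>x. \<lambda>i\<in>{..<N}. c i + r * x i"
  let ?B = "{x \<in> space (RN N). norm2 N (\<lambda>i. x i - c i) \<le> r}"
  \<comment> \<open>The singleton of the origin: a box with sides of length zero, hence a null set
    for \<open>N > 0\<close>. It is what \<open>punctured_ball\<close> lacks of the closed unit
    ball.\<close>
  let ?O = "\<Pi>\<^sub>E i\<in>{..<N}. {0::real}"
  have B: "?B \<in> sets (RN N)"
    unfolding L2_set_def RN_def by measurable
  have O: "?O \<in> sets (RN N)"
    unfolding RN_def by (intro sets_PiM_I_finite) auto
  have O0: "emeasure (RN N) ?O = 0"
    unfolding RN_def using N by (subst emeasure_PiM) auto
  have norm_T: "norm2 N (\<lambda>i. ?T x i - c i) = r * norm2 N x" for x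
  proof -
    have "norm2 N (\<lambda>i. ?T x i - c i) = norm2 N (\<lambda>i. r * x i)"
      by (rule L2_set_cong) auto
    then show ?thesis using r by (simp add: L2_set_right_distrib)
  qed
  have T_B: "?T x \<in> ?B \<longleftrightarrow> norm2 N x \<le> 1" for x
  proof -
    have "?T x \<in> space (RN N)" by (simp add: space_RN)
    moreover have "r * norm2 N x \<le> r \<longleftrightarrow> norm2 N x \<le> 1"
      using mult_le_cancel_left_pos[OF r, of "norm2 N x" 1] by simp
    ultimately show ?thesis unfolding mem_Collect_eq norm_T by blast
  qed
  have "?T -` ?B \<inter> space (RN N) = {x \<in> space (RN N). norm2 N x \<le> 1}"
    using T_B by blast
  also have "\<dots> = punctured_ball N \<union> ?O"
  proof -
    have "x \<in> ?O \<longleftrightarrow> x \<in> space (RN N) \<and> norm2 N x = 0" for x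
      by (auto simp: L2_set_eq_0_iff space_RN PiE_iff extensional_def intro!: ext)
    moreover have "0 < norm2 N x \<longleftrightarrow> norm2 N x \<noteq> 0" for x
      using L2_set_nonneg[of x "{..<N}"] by linarith
    ultimately show ?thesis
      unfolding punctured_ball_def set_eq_iff Un_iff mem_Collect_eq by (metis zero_le_one)
  qed
  finally show ?thesis
    using emeasure_RN_affine[OF r B, of c] emeasure_Un_null_set[of "punctured_ball N" "RN N" ?O] O O0
    by (simp add: null_sets_def)
qed

section \<open>Probability of spherical caps\<close>

text \<open>Turns probabilities on the sphere into ratios of volumes: the set in the numerator is
  the cone over \<open>A\<close> inside the unit ball, without its apex.\<close>

lemma emeasure_uniform_sphere:
  assumes A: "A \<in> sets (restrict_space (RN N) (unit_sphere N))"
  shows "emeasure (uniform_sphere N) A =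
    emeasure (RN N) {x \<in> punctured_ball N. radial_proj N x \<in> A} / emeasure (RN N) (punctured_ball N)"
proof -
  let ?R = "restrict_space (RN N) (punctured_ball N)"
  let ?S = "{x \<in> punctured_ball N. radial_proj N x \<in> A}"
  have sp: "space ?R = punctured_ball N"
    by (auto simp: space_restrict_space punctured_ball_def)
  have pre: "radial_proj N -` A \<inter> punctured_ball N = ?S"
    by auto
  have S: "?S \<in> sets ?R"
    using measurable_sets[OF measurable_radial_proj A] by (simp only: sp pre)
  have "emeasure (uniform_sphere N) A = emeasure (uniform_measure ?R (punctured_ball N)) ?S"
    unfolding uniform_sphere_def using A measurable_radial_proj
    by (subst emeasure_distr) (simp_all add: sp pre del: emeasure_uniform_measure)
  also have "\<dots> = emeasure ?R ?S / emeasure ?R (punctured_ball N)"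
    using S sets.top[of ?R] by (subst emeasure_uniform_measure) (auto simp: sp intro!: arg_cong2[where f="(/)"] arg_cong2[where f=emeasure])
  also have "\<dots> = emeasure (RN N) ?S / emeasure (RN N) (punctured_ball N)"
    by (subst (1 2) emeasure_restrict_space) auto
  finally show ?thesis .
qed

text \<open>Expanding the square bounds the squared distance from \<open>x\<close> to
  \<open>s t e_i\<close> by \<open>r^2 - 2 t^2 r + t^2\<close> with \<open>r = norm2 N x\<close>.
  This is convex in \<open>r\<close>, with values \<open>t^2\<close> at 0 and \<open>1 - t^2\<close>
  at 1, and the latter is the larger one when \<open>t^2 \<le> 1/2\<close>.\<close>

lemma cone_subset_ball:
  assumes i: "i < N" and s: "\<bar>s\<bar> = (1::real)" and t: "0 \<le> t" "t\<^sup>2 \<le> 1 / 2"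
    and x: "norm2 N x \<le> 1" and cone: "t * norm2 N x \<le> s * x i"
  shows "norm2 N (\<lambda>j. x j - (if j = i then s * t else 0)) \<le> sqrt (1 - t\<^sup>2)"
proof -
  let ?r = "norm2 N x"
  have r0: "0 \<le> ?r" by (rule L2_set_nonneg)
  have s2: "s\<^sup>2 = 1" using s by (metis power2_abs power_one)
  have "(\<Sum>j<N. (x j - (if j = i then s * t else 0))\<^sup>2)
      = (\<Sum>j<N. (x j)\<^sup>2 + (if j = i then t\<^sup>2 - 2 * t * (s * x i) else 0))"
    using s2 by (intro sum.cong) (auto simp: power2_diff power_mult_distrib algebra_simps)
  also have "\<dots> = ?r\<^sup>2 + (t\<^sup>2 - 2 * t * (s * x i))"
    using i by (simp add: sum.distrib L2_set_def sum_nonneg)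
  also have "\<dots> \<le> ?r\<^sup>2 + (t\<^sup>2 - 2 * t * (t * ?r))"
    using cone t by (simp add: mult_left_mono)
  also have "\<dots> \<le> 1 - t\<^sup>2"
  proof -
    \<comment> \<open>The goal rearranges to \<open>r^2 + 2 t^2 (1 - r) \<le> 1\<close>, the sum of
      the next two inequalities.\<close>
    have "?r * ?r \<le> ?r" using r0 x by (simp add: mult_left_le)
    moreover have "2 * t\<^sup>2 * (1 - ?r) \<le> 1 * (1 - ?r)"
      using t x by (intro mult_right_mono) auto
    ultimately show ?thesis by (simp add: power2_eq_square algebra_simps)
  qed
  finally show ?thesis by (simp add: L2_set_def)
qed

text \<open>The cone over the cap lies in a ball of radius \<open>sqrt (1 - t^2)\<close>, so its
  share of the unit ball is at most the \<open>N\<close>-th power of that radius. The sign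
  \<open>s\<close> treats the caps around \<open>e_i\<close> and \<open>- e_i\<close>
  together.\<close>

lemma uniform_sphere_cap:
  assumes i: "i < N" and s: "\<bar>s\<bar> = (1::real)" and t: "0 \<le> t" "t\<^sup>2 \<le> 1 / 2"
  shows "emeasure (uniform_sphere N) {v \<in> unit_sphere N. t \<le> s * v i} \<le> ennreal (exp (- real N * t\<^sup>2 / 2))"
proof -
  let ?A = "{v \<in> unit_sphere N. t \<le> s * v i}"
  let ?c = "\<lambda>j. if j = i then s * t else 0"
  let ?b = "emeasure (RN N) (punctured_ball N)"
  have N: "N > 0" using i by simp
  note b = emeasure_punctured_ball[OF N]
  have A: "?A \<in> sets (restrict_space (RN N) (unit_sphere N))"
  proof -
    have "(\<lambda>v. v i) \<in> borel_measurable (RN N)"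
      unfolding RN_def using i by simp
    then have "{v \<in> space (RN N). t \<le> s * v i} \<inter> unit_sphere N \<in> sets (RN N)"
      by measurable
    moreover have "{v \<in> space (RN N). t \<le> s * v i} \<inter> unit_sphere N = ?A"
      by (auto simp: unit_sphere_def)
    ultimately show ?thesis by (auto simp: sets_restrict_space_iff)
  qed
  have r: "sqrt (1 - t\<^sup>2) > 0" using t by simp
  \<comment> \<open>On the punctured ball the norm is positive, so clearing the denominator in
    \<open>radial_proj\<close> yields the cone condition.\<close>
  have "{x \<in> punctured_ball N. radial_proj N x \<in> ?A}
      \<subseteq> {x \<in> space (RN N). norm2 N (\<lambda>j. x j - ?c j) \<le> sqrt (1 - t\<^sup>2)}"
    using cone_subset_ball[OF i s t] i
    by (auto simp: punctured_ball_def radial_proj_def field_simps)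
  then have "emeasure (RN N) {x \<in> punctured_ball N. radial_proj N x \<in> ?A}
      \<le> emeasure (RN N) {x \<in> space (RN N). norm2 N (\<lambda>j. x j - ?c j) \<le> sqrt (1 - t\<^sup>2)}"
    by (rule emeasure_mono) (unfold L2_set_def RN_def, measurable)
  also have "\<dots> = ennreal (sqrt (1 - t\<^sup>2)) ^ N * ?b"
    by (rule emeasure_RN_ball[OF N r])
  finally have "emeasure (uniform_sphere N) ?A \<le> ennreal (sqrt (1 - t\<^sup>2)) ^ N * ?b / ?b"
    unfolding emeasure_uniform_sphere[OF A] by (rule divide_right_mono_ennreal)
  \<comment> \<open>Cancelling \<open>?b\<close> in \<open>ennreal\<close> requires it to be neither
    zero nor infinite.\<close>
  also have "\<dots> = ennreal (sqrt (1 - t\<^sup>2) ^ N)"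
    using b r by (simp add: ennreal_mult_divide_eq ennreal_power)
  also have "\<dots> \<le> ennreal (exp (- real N * t\<^sup>2 / 2))"
  proof (rule ennreal_leI)
    have "1 - t\<^sup>2 \<le> exp (- t\<^sup>2)"
      using exp_ge_add_one_self[of "- t\<^sup>2"] by simp
    also have "\<dots> = (exp (- t\<^sup>2 / 2))\<^sup>2"
      by (simp add: exp_of_nat_mult[symmetric])
    finally have "sqrt (1 - t\<^sup>2) \<le> exp (- t\<^sup>2 / 2)"
      by (intro real_le_lsqrt) auto
    then have "sqrt (1 - t\<^sup>2) ^ N \<le> exp (- t\<^sup>2 / 2) ^ N"
      using r by (intro power_mono) auto
    then show "sqrt (1 - t\<^sup>2) ^ N \<le> exp (- real N * t\<^sup>2 / 2)"
      by (simp add: exp_of_nat_mult[symmetric])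
  qed
  finally show ?thesis .
qed

section \<open>Tail and expectation of the maximum norm\<close>

lemma measurable_norm_inf:
  assumes "N > 0"
  shows "norm_inf N \<in> borel_measurable (RN N)"
proof -
  have "(\<lambda>v. v i) \<in> borel_measurable (RN N)" if "i < N" for i
    unfolding RN_def using that by simp
  then show ?thesis
    unfolding norm_inf_def by (intro borel_measurable_Max borel_measurable_abs) auto
qed

text \<open>No coordinate exceeds the Euclidean norm in absolute value. The bound by 1 gives
  integrability and controls the maximum norm on the tail event.\<close>

lemma norm_inf_unit_sphere:
  assumes N: "N > 0" and v: "v \<in> unit_sphere N"
  shows "0 \<le> norm_inf N v" "norm_inf N v \<le> 1"
proof -
  have "\<bar>v i\<bar> \<le> 1" if "i < N" for i
    using member_le_L2_set[of "{..<N}" i "\<lambda>i. \<bar>v i\<bar>"] that v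
    by (simp add: unit_sphere_def L2_set_def)
  then show "norm_inf N v \<le> 1"
    unfolding norm_inf_def using N by (subst Max_le_iff) auto
  have "0 \<le> \<bar>v 0\<bar>" by simp
  also have "\<dots> \<le> norm_inf N v"
    unfolding norm_inf_def using N by (intro Max_ge) auto
  finally show "0 \<le> norm_inf N v" .
qed

lemma measurable_norm_inf_uniform_sphere:
  "N > 0 \<Longrightarrow> norm_inf N \<in> borel_measurable (uniform_sphere N)"
  unfolding uniform_sphere_def by (simp add: measurable_restrict_space1 measurable_norm_inf)

lemma integrable_norm_inf:
  assumes N: "N > 0"
  shows "integrable (uniform_sphere N) (norm_inf N)"
proof -
  interpret prob_space "uniform_sphere N" by (rule prob_space_uniform_sphere[OF N])
  show ?thesis
    using norm_inf_unit_sphere[OF N] measurable_norm_inf_uniform_sphere[OF N]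
    by (intro integrable_const_bound[where B=1]) (auto simp: space_uniform_sphere)
qed

text \<open>The maximum is attained at some coordinate, whose index and sign select one of
  \<open>2 N\<close> caps containing \<open>v\<close>; the union bound finishes.\<close>

lemma norm_inf_tail:
  assumes N: "N > 0" and t: "0 \<le> t" "t\<^sup>2 \<le> 1 / 2"
  shows "measure (uniform_sphere N) {v \<in> unit_sphere N. t \<le> norm_inf N v}
    \<le> 2 * real N * exp (- real N * t\<^sup>2 / 2)"
proof -
  interpret prob_space "uniform_sphere N" by (rule prob_space_uniform_sphere[OF N])
  let ?e = "exp (- real N * t\<^sup>2 / 2)"
  let ?A = "\<lambda>(i, s). {v \<in> unit_sphere N. t \<le> s * v i}"
  let ?I = "{..<N} \<times> {1, - 1 :: real}"
  have sub: "{v \<in> unit_sphere N. t \<le> norm_inf N v} \<subseteq> (\<Union>p\<in>?I. ?A p)"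
  proof
    fix v assume v: "v \<in> {v \<in> unit_sphere N. t \<le> norm_inf N v}"
    have "norm_inf N v \<in> (\<lambda>i. \<bar>v i\<bar>) ` {..<N}"
      unfolding norm_inf_def using N by (intro Max_in) auto
    then obtain i where "i < N" "norm_inf N v = \<bar>v i\<bar>" by auto
    moreover define s :: real where "s = (if v i \<ge> 0 then 1 else - 1)"
    ultimately have "v \<in> ?A (i, s)" "(i, s) \<in> ?I" using v by (auto simp: abs_if)
    then show "v \<in> (\<Union>p\<in>?I. ?A p)" by blast
  qed
  have A: "?A p \<in> events" if p: "p \<in> ?I" for p
  proof -
    obtain i s where [simp]: "p = (i, s)" and i: "i < N" using p by auto
    have "(\<lambda>v. v i) \<in> borel_measurable (uniform_sphere N)"
      unfolding uniform_sphere_def RN_def using i by (simp add: measurable_restrict_space1)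
    then have "{v \<in> space (uniform_sphere N). t \<le> s * v i} \<in> events"
      by measurable
    then show ?thesis by (simp add: space_uniform_sphere)
  qed
  have "prob {v \<in> unit_sphere N. t \<le> norm_inf N v} \<le> prob (\<Union>p\<in>?I. ?A p)"
    using sub A by (intro finite_measure_mono sets.finite_UN) auto
  also have "\<dots> \<le> (\<Sum>p\<in>?I. prob (?A p))"
    using A by (intro finite_measure_subadditive_finite) auto
  also have "\<dots> \<le> (\<Sum>p\<in>?I. ?e)"
  proof (rule sum_mono)
    fix p assume "p \<in> ?I"
    then obtain i s where "p = (i, s)" "i < N" "\<bar>s\<bar> = 1" by auto
    then show "prob (?A p) \<le> ?e"
      using uniform_sphere_cap[of i N s t] t by (simp add: emeasure_eq_measure)
  qed
  also have "\<dots> = 2 * real N * ?e"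
    by (simp add: card_cartesian_product)
  finally show ?thesis .
qed

text \<open>Integrate the pointwise bound by \<open>t\<close> plus the indicator of the tail event:
  the maximum norm is below \<open>t\<close> off the event and at most 1 on it. The level
  \<open>t\<close> stays free until the dimension is fixed.\<close>

lemma expectation_norm_inf_le:
  assumes N: "N > 0" and t: "0 \<le> t" "t\<^sup>2 \<le> 1 / 2"
  shows "(LINT v|uniform_sphere N. norm_inf N v) \<le> t + 2 * real N * exp (- real N * t\<^sup>2 / 2)"
proof -
  interpret prob_space "uniform_sphere N" by (rule prob_space_uniform_sphere[OF N])
  let ?S = "{v \<in> unit_sphere N. t \<le> norm_inf N v}"
  have S: "?S \<in> events"
  proof -
    have "{v \<in> space (uniform_sphere N). t \<le> norm_inf N v} \<in> events"
      using measurable_norm_inf_uniform_sphere[OF N] by measurable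
    then show ?thesis by (simp add: space_uniform_sphere)
  qed
  have "(LINT v|uniform_sphere N. norm_inf N v) \<le> (LINT v|uniform_sphere N. t + indicator ?S v)"
  proof (rule integral_mono[OF integrable_norm_inf[OF N]])
    show "integrable (uniform_sphere N) (\<lambda>v. t + indicator ?S v)"
      using S by (simp add: less_top[symmetric])
    fix v assume "v \<in> space (uniform_sphere N)"
    then show "norm_inf N v \<le> t + indicator ?S v"
      using norm_inf_unit_sphere[OF N, of v] t
      by (auto simp: space_uniform_sphere indicator_def)
  qed
  also have "\<dots> = t + prob ?S"
    using S by (simp add: prob_space less_top[symmetric])
  finally show ?thesis using norm_inf_tail[OF N t] by simp
qed

section \<open>The expected runtime\<close>

lemma tau_unit_sphere:
  assumes v: "v \<in> unit_sphere (2 ^ n)"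
  shows "tau n v = real n * sqrt (2 ^ n * (norm_inf (2 ^ n) v)\<^sup>2)"
proof -
  have "(\<Sum>i<2 ^ n. (v i)\<^sup>2) = 1"
    using v by (simp add: unit_sphere_def L2_set_def)
  then have "data_density (2 ^ n) v = inverse (2 ^ n * (norm_inf (2 ^ n) v)\<^sup>2)"
    by (simp add: data_density_def power_divide sum_divide_distrib[symmetric] inverse_eq_divide)
  then show ?thesis
    \<comment> \<open>The double inverse cancels at zero too, which spares a separate proof that the
      maximum norm is nonzero.\<close>
    by (simp only: tau_def real_sqrt_inverse divide_inverse inverse_inverse_eq)
qed

text \<open>Linearity in the maximum norm is what transfers integrability and expectation to
  \<open>tau\<close>.\<close>

lemma tau_eq_norm_inf:
  assumes v: "v \<in> unit_sphere (2 ^ n)"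
  shows "tau n v = real n * sqrt (2 ^ n) * norm_inf (2 ^ n) v"
  using norm_inf_unit_sphere(1)[OF _ v] by (simp add: tau_unit_sphere[OF v] real_sqrt_mult)

lemma integrable_tau: "integrable (uniform_sphere (2 ^ n)) (tau n)"
proof -
  have "integrable (uniform_sphere (2 ^ n)) (\<lambda>v. real n * sqrt (2 ^ n) * norm_inf (2 ^ n) v)"
    by (intro integrable_mult_right integrable_norm_inf) simp
  then show ?thesis
    by (subst Bochner_Integration.integrable_cong[OF refl tau_eq_norm_inf]) (simp_all add: space_uniform_sphere)
qed

lemma expectation_tau:
  "(LINT v|uniform_sphere (2 ^ n). tau n v)
    = real n * sqrt (2 ^ n) * (LINT v|uniform_sphere (2 ^ n). norm_inf (2 ^ n) v)"
  by (subst Bochner_Integration.integral_cong[OF refl tau_eq_norm_inf])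
    (simp_all add: space_uniform_sphere)

text \<open>With \<open>N = 2 ^ n\<close>, the level \<open>?t\<close> makes the exponent
  \<open>N t^2 / 2\<close> equal to \<open>3 n / 2\<close>. After multiplication by
  \<open>sqrt N\<close> the level contributes \<open>sqrt (3 n)\<close> and the tail at most
  2.\<close>

lemma expectation_tau_le:
  assumes n: "n \<ge> 5"
  shows "(LINT v|uniform_sphere (2 ^ n). tau n v) \<le> 4 * real n powr (3 / 2)"
proof -
  let ?t = "sqrt (3 * real n / 2 ^ n)"
  \<comment> \<open>This is the condition \<open>?t^2 \<le> 1/2\<close>; the induction starts from
    \<open>30 \<le> 32\<close> at \<open>n = 5\<close>, while \<open>n = 4\<close> would
    fail.\<close>
  have six: "6 * n \<le> 2 ^ n"
    using n by (induction n rule: dec_induct) auto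
  have "real (6 * n) \<le> real (2 ^ n)" using six by (simp only: of_nat_le_iff)
  then have "?t\<^sup>2 \<le> 1 / 2" by (simp add: field_simps)
  then have le: "(LINT v|uniform_sphere (2 ^ n). norm_inf (2 ^ n) v)
      \<le> ?t + 2 * 2 ^ n * exp (- (3 / 2 * real n))"
    using expectation_norm_inf_le[of "2 ^ n" ?t] by simp
  \<comment> \<open>Only \<open>2 \<le> exp 1\<close> is used: it bounds
    \<open>exp (- 3 n / 2)\<close> by \<open>N powr (- 3 / 2)\<close>, which beats the factor
    \<open>2 N\<close> of the union bound by \<open>sqrt N\<close>.\<close>
  have "(2::real) powr (3 / 2 * real n) \<le> exp 1 powr (3 / 2 * real n)"
    using exp_ge_add_one_self[of 1] by (intro powr_mono2) auto
  then have "2 powr (3 / 2 * real n) \<le> exp (3 / 2 * real n)"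
    by (simp add: powr_def)
  moreover have "(2::real) powr (3 / 2 * real n) = 2 ^ n * sqrt (2 ^ n)"
  proof -
    have "(2::real) powr (3 / 2 * real n) = 2 powr real n * 2 powr (real n * (1 / 2))"
      unfolding powr_add[symmetric] by (simp add: field_simps)
    also have "(2::real) powr (real n * (1 / 2)) = sqrt (2 powr real n)"
      unfolding powr_powr[symmetric] by (rule powr_half_sqrt) simp
    finally show ?thesis by (simp add: powr_realpow)
  qed
  ultimately have "exp (- (3 / 2 * real n)) \<le> 1 / (2 ^ n * sqrt (2 ^ n))"
    unfolding exp_minus inverse_eq_divide by (intro divide_left_mono) auto
  then have "2 * 2 ^ n * exp (- (3 / 2 * real n)) \<le> 2 * 2 ^ n * (1 / (2 ^ n * sqrt (2 ^ n)))"
    by (rule mult_left_mono) simp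
  then have "2 * 2 ^ n * exp (- (3 / 2 * real n)) \<le> 2 / sqrt (2 ^ n)"
    by simp
  with le have "sqrt (2 ^ n) * (LINT v|uniform_sphere (2 ^ n). norm_inf (2 ^ n) v)
      \<le> sqrt (2 ^ n) * (?t + 2 / sqrt (2 ^ n))"
    by (intro mult_left_mono) auto
  also have "\<dots> = sqrt 3 * sqrt n + 2"
    by (simp add: real_sqrt_mult real_sqrt_divide field_simps)
  \<comment> \<open>Uses \<open>sqrt 3 \<le> 2\<close> and \<open>1 \<le> sqrt n\<close>; hence the
    constant 4.\<close>
  also have "\<dots> \<le> 2 * sqrt n + 2 * sqrt n"
    using n by (intro add_mono mult_right_mono) (auto intro: real_le_lsqrt)
  finally have "real n * (sqrt (2 ^ n) * (LINT v|uniform_sphere (2 ^ n). norm_inf (2 ^ n) v))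
      \<le> real n * (4 * sqrt n)"
    by (intro mult_left_mono) auto
  moreover have "real n powr (3 / 2) = real n * sqrt n"
    using n powr_add[of "real n" 1 "1 / 2"] by (simp add: powr_half_sqrt)
  ultimately show ?thesis
    by (simp add: expectation_tau mult.assoc)
qed

lemma expectation_tau_nonneg: "0 \<le> (LINT v|uniform_sphere (2 ^ n). tau n v)"
  by (intro Bochner_Integration.integral_nonneg)
    (simp add: space_uniform_sphere tau_unit_sphere)

theorem mainTheorem2:
  shows "(\<forall>n. \<forall>v\<in>unit_sphere (2 ^ n).
            tau n v = real n * sqrt (2 ^ n * (norm_inf (2 ^ n) v)\<^sup>2))
       \<and> (\<forall>n. integrable (uniform_sphere (2 ^ n)) (tau n))
       \<and> (\<lambda>n. LINT v|uniform_sphere (2 ^ n). tau n v) \<in> O(\<lambda>n. real n powr (3 / 2))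
       \<and> (\<lambda>n. LINT v|uniform_sphere (2 ^ n). tau n v) \<in> O(\<lambda>n. ln (real (2 ^ n)) powr (3 / 2))"
proof -
  have O: "(\<lambda>n. LINT v|uniform_sphere (2 ^ n). tau n v) \<in> O(\<lambda>n. real n powr (3 / 2))"
  proof (rule bigoI)
    show "\<forall>\<^sub>F n in sequentially. norm (LINT v|uniform_sphere (2 ^ n). tau n v)
        \<le> 4 * norm (real n powr (3 / 2))"
      using eventually_ge_at_top[of 5]
      by eventually_elim (use expectation_tau_le expectation_tau_nonneg in simp)
  qed
  \<comment> \<open>Since \<open>ln (2 ^ n) = n * ln 2\<close>, the two growth rates differ by a
    nonzero constant factor.\<close>
  have "(\<lambda>n. ln (real (2 ^ n)) powr (3 / 2)) = (\<lambda>n. ln 2 powr (3 / 2) * real n powr (3 / 2))"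
    by (auto simp: ln_realpow powr_mult mult.commute)
  then have "(\<lambda>n. real n powr (3 / 2)) \<in> O(\<lambda>n. ln (real (2 ^ n)) powr (3 / 2))"
    by simp
  then show ?thesis
    using O landau_o.big_trans tau_unit_sphere integrable_tau by blast
qed

end
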